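(* Let $E$ be a finite set and let $\mathcal{F}$ be a collection of subsets of $E$. Let $j_1<\dots<j_k$ be the distinct cardinalities of the members of $\mathcal{F}$, and for $i=1,\dots,k$ let $\mathcal{B}_i=\{F\in\mathcal{F}: |F|=j_i\}$. Consider the following two axioms: (1) if $F,G\in\mathcal{F}$ satisfy $|F|=|G|$ and $x\in F\setminus G$, then there exists $y\in G\setminus F$ such that $(G\cup\{x\})\setminus\{y\}\in\mathcal{F}$; (2) if $\mathcal{F}$ contains sets of different cardinalities, then for every $F\in\mathcal{F}$ whose cardinality is not the minimum cardinality occurring in $\mathcal{F}$ and every $e\in E\setminus F$, there exists $G\in\mathcal{F}$ with $G\subsetneq F$, $|G|=\max\{|S|: S\in\mathcal{F},\ |S|<|F|\}$, and $$\{f : (G\cup\{e\})\setminus\{f\}\in\mathcal{F}\}\subseteq\{f : (F\cup\{e\})\setminus\{f\}\in\mathcal{F}\}.$$ Then $(E,\mathcal{F})$ satisfies axioms (1) and (2) if and only if each $\mathcal{B}_i$ is the set of bases of a matroid $M_i$ on $E$ and, for each $i=1,\dots,k-1$, $M_{i+1}$ is a nontrivial lift of $M_i$.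
   Context: For matroids $M,N$ on a common ground set $E$, $N$ is a lift of $M$ (equivalently $M$ is a quotient of $N$) if every flat of $M$ is a flat of $N$; the lift is nontrivial if $N\neq M$.
   Formalization: In axiom (2) the element f is required to lie in G∪{e} (respectively F∪{e}); with f unrestricted the equivalence fails, e.g. for all 1- and 2-element subsets of a 4-element set. *)

theory Defs
  imports Main
begin

locale matroid =
  fixes E :: "'a set" and I :: "'a set set"
  assumes finite_ground: "finite E"
    and indep_subset_ground: "I \<subseteq> Pow E"
    and empty_indep: "{} \<in> I"
    and indep_hereditary: "X \<in> I \<Longrightarrow> Y \<subseteq> X \<Longrightarrow> Y \<in> I"
    and indep_augment: "X \<in> I \<Longrightarrow> Y \<in> I \<Longrightarrow> card X < card Y \<Longrightarrow> \<exists>y\<in>Y - X. insert y X \<in> I"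

definition bases :: "'a set set \<Rightarrow> 'a set set" where
  "bases I = {B \<in> I. \<forall>X\<in>I. B \<subseteq> X \<longrightarrow> X = B}"

definition matroid_rank :: "'a set set \<Rightarrow> 'a set \<Rightarrow> nat" where
  "matroid_rank I X = Max (card ` {Y \<in> I. Y \<subseteq> X})"

definition flats :: "'a set \<Rightarrow> 'a set set \<Rightarrow> 'a set set" where
  "flats E I = {X. X \<subseteq> E \<and> (\<forall>e\<in>E - X. matroid_rank I X < matroid_rank I (insert e X))}"

definition is_lift :: "'a set \<Rightarrow> 'a set set \<Rightarrow> 'a set set \<Rightarrow> bool" where
  "is_lift E N M \<longleftrightarrow> matroid E N \<and> matroid E M \<and> flats E M \<subseteq> flats E N"

definition nontrivial_lift :: "'a set \<Rightarrow> 'a set set \<Rightarrow> 'a set set \<Rightarrow> bool" where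
  "nontrivial_lift E N M \<longleftrightarrow> is_lift E N M \<and> N \<noteq> M"

definition axiom1 :: "'a set set \<Rightarrow> bool" where
  "axiom1 \<F> \<longleftrightarrow>
    (\<forall>F\<in>\<F>. \<forall>G\<in>\<F>. \<forall>x. card F = card G \<and> x \<in> F - G \<longrightarrow>
       (\<exists>y\<in>G - F. (G \<union> {x}) - {y} \<in> \<F>))"

text \<open>The element removed in an exchange is required to lie in the set it is removed from.
  Otherwise \<open>(G \<union> {e}) - {f}\<close> could be \<open>G \<union> {e}\<close> itself, which may be a member of \<open>\<F>\<close> of the next
  larger size, and the uniform matroids of ranks 1 and 2 on four elements would violate
  \<open>axiom2\<close> below.\<close>

definition exchangeable :: "'a set set \<Rightarrow> 'a set \<Rightarrow> 'a \<Rightarrow> 'a set" where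
  "exchangeable \<F> G e = {f \<in> G \<union> {e}. (G \<union> {e}) - {f} \<in> \<F>}"

definition axiom2 :: "'a set \<Rightarrow> 'a set set \<Rightarrow> bool" where
  "axiom2 E \<F> \<longleftrightarrow>
    ((\<exists>S\<in>\<F>. \<exists>T\<in>\<F>. card S \<noteq> card T) \<longrightarrow>
      (\<forall>F\<in>\<F>. card F \<noteq> Min (card ` \<F>) \<longrightarrow>
        (\<forall>e\<in>E - F. \<exists>G\<in>\<F>. G \<subset> F \<and> card G = Max {card S | S. S \<in> \<F> \<and> card S < card F} \<and>
           exchangeable \<F> G e \<subseteq> exchangeable \<F> F e)))"

end

theory Submission
  imports Defs
begin

text \<open>The set \<open>exchangeable (bases I) G e\<close> is the fundamental circuit of \<open>e\<close> with respect to the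
  basis \<open>G\<close>. If \<open>N\<close> is a lift of \<open>M\<close>, then \<open>M\<close>-closures contain \<open>N\<close>-closures, so a basis \<open>F\<close> of
  \<open>N\<close> spans \<open>M\<close>, and the fundamental \<open>N\<close>-circuit \<open>C\<close> of \<open>e\<close> over \<open>F\<close> has \<open>e\<close> in the \<open>M\<close>-closure of
  \<open>C - {e}\<close>. Extending a maximal \<open>M\<close>-independent subset of \<open>C - {e}\<close> inside \<open>F\<close> gives the basis
  \<open>G\<close> demanded by the second axiom. Conversely, if a flat \<open>X\<close> of \<open>M\<close> is not a flat of \<open>N\<close>, some
  \<open>e\<close> outside \<open>X\<close> lies on an \<open>N\<close>-circuit inside \<open>X \<union> {e}\<close>; this is the fundamental circuit over some
  basis \<open>F\<close>, and the \<open>M\<close>-circuit it contains by the second axiom puts \<open>e\<close> in the \<open>M\<close>-closure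
  of \<open>X\<close>.\<close>

section \<open>Independent sets, flats and bases of a single matroid\<close>

context matroid
begin

lemma indep_finite: "X \<in> I \<Longrightarrow> finite X"
  using finite_ground indep_subset_ground finite_subset by blast

lemma finite_indeps: "finite I"
  using finite_ground indep_subset_ground finite_subset by blast

lemma indep_extend:
  assumes "X \<in> I" "Y \<in> I" "card X \<le> card Y"
  shows "\<exists>A\<in>I. X \<subseteq> A \<and> A \<subseteq> X \<union> Y \<and> card A = card Y"
  using assms
proof (induction "card Y - card X" arbitrary: X)
  case 0
  then show ?case by (intro bexI[of _ X]) auto
next
  case (Suc n)
  then obtain y where y: "y \<in> Y - X" "insert y X \<in> I"
    using indep_augment[of X Y] by force
  have "card (insert y X) = Suc (card X)"
    using y indep_finite[OF Suc.prems(1)] by simp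
  then have "\<exists>A\<in>I. insert y X \<subseteq> A \<and> A \<subseteq> insert y X \<union> Y \<and> card A = card Y"
    using Suc.hyps(1)[of "insert y X"] Suc.hyps(2) Suc.prems y by simp
  then show ?case using y by blast
qed

lemma max_indep_exists:
  assumes "A \<in> I" "A \<subseteq> X"
  obtains B where "B \<in> I" "A \<subseteq> B" "B \<subseteq> X" "\<And>Y. Y \<in> I \<Longrightarrow> Y \<subseteq> X \<Longrightarrow> card Y \<le> card B"
proof -
  let ?S = "{Y \<in> I. Y \<subseteq> X}"
  have fin: "finite (card ` ?S)" using finite_indeps by simp
  have ne: "card ` ?S \<noteq> {}" using assms by blast
  obtain C where C: "C \<in> I" "C \<subseteq> X" "card C = Max (card ` ?S)"
    using Max_in[OF fin ne] by auto
  have C_max: "card Y \<le> card C" if "Y \<in> I" "Y \<subseteq> X" for Y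
    using C(3) Max_ge[OF fin] that by auto
  \<comment> \<open>\<open>A\<close> grows only by elements of the largest \<open>C\<close>, so
    \<open>B\<close> stays inside \<open>X\<close> and has maximum size.\<close>
  obtain B where "B \<in> I" "A \<subseteq> B" "B \<subseteq> A \<union> C" "card B = card C"
    using indep_extend[OF assms(1) C(1) C_max[OF assms]] by blast
  then show thesis using that C_max C assms(2) by (metis Un_least subset_trans)
qed

lemma rank_eqI:
  assumes "B \<in> I" "B \<subseteq> X" "\<And>Y. Y \<in> I \<Longrightarrow> Y \<subseteq> X \<Longrightarrow> card Y \<le> card B"
  shows "matroid_rank I X = card B"
  unfolding matroid_rank_def using finite_indeps assms by (intro Max_eqI) auto

lemma rank_ge: "Y \<in> I \<Longrightarrow> Y \<subseteq> X \<Longrightarrow> card Y \<le> matroid_rank I X"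
  unfolding matroid_rank_def using finite_indeps by (intro Max_ge) auto

text \<open>A maximum independent subset \<open>B\<close> of \<open>X\<close> decides whether
  \<open>e\<close> raises the rank: it does exactly when \<open>insert e B\<close> is independent.
  This form trades ranks for extensions of independent sets.\<close>

lemma flat_iff:
  "X \<in> flats E I \<longleftrightarrow> X \<subseteq> E \<and> (\<forall>e\<in>E - X. \<forall>A\<in>I. A \<subseteq> X \<longrightarrow> insert e A \<in> I)"
proof -
  have "matroid_rank I X < matroid_rank I (insert e X) \<longleftrightarrow>
      (\<forall>A\<in>I. A \<subseteq> X \<longrightarrow> insert e A \<in> I)" if e: "e \<in> E - X" for e
  proof
    assume less: "matroid_rank I X < matroid_rank I (insert e X)"
    show "\<forall>A\<in>I. A \<subseteq> X \<longrightarrow> insert e A \<in> I"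
    proof (intro ballI impI)
      fix A assume "A \<in> I" "A \<subseteq> X"
      then obtain B where B: "B \<in> I" "A \<subseteq> B" "B \<subseteq> X"
        and B_max: "\<And>Y. Y \<in> I \<Longrightarrow> Y \<subseteq> X \<Longrightarrow> card Y \<le> card B"
        using max_indep_exists by metis
      obtain Y where Y: "Y \<in> I" "Y \<subseteq> insert e X"
        and Y_max: "\<And>Z. Z \<in> I \<Longrightarrow> Z \<subseteq> insert e X \<Longrightarrow> card Z \<le> card Y"
        using max_indep_exists[OF empty_indep, of "insert e X"] by auto
      have "card B < card Y"
        using less rank_eqI[OF B(1,3) B_max] rank_eqI[OF Y Y_max] by simp
      then obtain y where y: "y \<in> Y - B" "insert y B \<in> I"
        using indep_augment[OF B(1) Y(1)] by blast
      have "card (insert y B) = Suc (card B)" using y indep_finite[OF B(1)] by simp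
      \<comment> \<open>Maximality of \<open>B\<close> puts the augmenting element outside
        \<open>X\<close>, where \<open>Y\<close> offers only \<open>e\<close>.\<close>
      then have "\<not> insert y B \<subseteq> X" using B_max[OF y(2)] by auto
      then have "y = e" using y Y B by blast
      then show "insert e A \<in> I" using y B indep_hereditary by (meson insert_mono)
    qed
  next
    assume ext: "\<forall>A\<in>I. A \<subseteq> X \<longrightarrow> insert e A \<in> I"
    obtain B where B: "B \<in> I" "B \<subseteq> X"
      and B_max: "\<And>Y. Y \<in> I \<Longrightarrow> Y \<subseteq> X \<Longrightarrow> card Y \<le> card B"
      using max_indep_exists[OF empty_indep, of X] by auto
    have "insert e B \<in> I" using ext B by blast
    then have "card (insert e B) \<le> matroid_rank I (insert e X)"
      using B(2) by (intro rank_ge) auto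
    moreover have "card (insert e B) = Suc (card B)"
      using e B indep_finite by (auto simp: card_insert_if)
    ultimately show "matroid_rank I X < matroid_rank I (insert e X)"
      using rank_eqI[OF B B_max] by simp
  qed
  then show ?thesis unfolding flats_def by blast
qed

text \<open>The set is the closure of \<open>B\<close>: nothing in it augments \<open>B\<close>, so
  none of its independent subsets exceeds \<open>B\<close> in size. The lift hypothesis is later
  applied to these flats.\<close>

lemma closure_of_indep_is_flat:
  assumes B: "B \<in> I"
  shows "{x \<in> E. x \<in> B \<or> insert x B \<notin> I} \<in> flats E I" (is "?X \<in> _")
proof -
  have X_card: "card Y \<le> card B" if Y: "Y \<in> I" "Y \<subseteq> ?X" for Y
  proof (rule ccontr)
    assume "\<not> card Y \<le> card B"
    then obtain y where "y \<in> Y - B" "insert y B \<in> I"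
      using indep_augment[OF B Y(1)] by auto
    then show False using Y(2) by blast
  qed
  have "insert e A \<in> I" if e: "e \<in> E - ?X" and A: "A \<in> I" "A \<subseteq> ?X" for e A
  proof -
    have eB: "e \<notin> B" "insert e B \<in> I" using e by auto
    have card_eB: "card (insert e B) = Suc (card B)" using eB indep_finite[OF B] by simp
    then have "card A \<le> card (insert e B)" using X_card[OF A] by simp
    \<comment> \<open>\<open>D\<close> is one larger than \<open>B\<close>, too large for
      \<open>?X\<close>; as \<open>A\<close> and \<open>B\<close> lie in \<open>?X\<close>, it must
      contain \<open>e\<close>.\<close>
    then obtain D where D: "D \<in> I" "A \<subseteq> D" "D \<subseteq> A \<union> insert e B" "card D = card (insert e B)"
      using indep_extend[OF A(1) eB(2)] by blast
    have "B \<subseteq> ?X" using B indep_subset_ground by blast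
    moreover have "\<not> D \<subseteq> ?X" using X_card[OF D(1)] D(4) card_eB by auto
    ultimately have "e \<in> D" using D(3) A(2) by blast
    then show ?thesis using D(1,2) indep_hereditary[of D "insert e A"] by blast
  qed
  then show ?thesis unfolding flat_iff by blast
qed

lemma bases_iff: "B \<in> bases I \<longleftrightarrow> B \<in> I \<and> (\<forall>X\<in>I. card X \<le> card B)"
proof
  assume B: "B \<in> bases I"
  have "card X \<le> card B" if "X \<in> I" for X
    using indep_augment[of B X] B that unfolding bases_def by fastforce
  then show "B \<in> I \<and> (\<forall>X\<in>I. card X \<le> card B)" using B unfolding bases_def by blast
next
  assume "B \<in> I \<and> (\<forall>X\<in>I. card X \<le> card B)"
  then show "B \<in> bases I"
    unfolding bases_def using indep_finite by (auto dest: card_seteq)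
qed

lemma bases_card_eq: "B \<in> bases I \<Longrightarrow> B' \<in> bases I \<Longrightarrow> card B = card B'"
  unfolding bases_iff by (meson le_antisym)

lemma basis_extend:
  assumes "X \<in> I" "B \<in> bases I"
  shows "\<exists>A\<in>bases I. X \<subseteq> A \<and> A \<subseteq> X \<union> B"
proof -
  have B: "B \<in> I" "\<And>Y. Y \<in> I \<Longrightarrow> card Y \<le> card B" using assms(2) unfolding bases_iff by auto
  then obtain A where "A \<in> I" "X \<subseteq> A" "A \<subseteq> X \<union> B" "card A = card B"
    using indep_extend[OF assms(1) B(1)] assms(1) by blast
  then show ?thesis using B(2) unfolding bases_iff by (intro bexI[of _ A]) (auto simp: bases_iff)
qed

text \<open>A basis between \<open>insert x D\<close> and \<open>insert x G\<close> omits exactly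
  one element, by equal cardinality. Contrapositively, if \<open>D\<close> contains every element of
  \<open>G\<close> that can be traded for \<open>x\<close>, then \<open>insert x D\<close> is
  dependent.\<close>

lemma basis_extend_insert:
  assumes "G \<in> bases I" "D \<subseteq> G" "x \<notin> G" "insert x D \<in> I"
  shows "\<exists>y\<in>G - D. insert x G - {y} \<in> bases I"
proof -
  obtain A where A: "A \<in> bases I" "insert x D \<subseteq> A" "A \<subseteq> insert x G"
    using basis_extend[OF assms(4,1)] assms(2) by blast
  have finG: "finite G" using assms(1) indep_finite unfolding bases_iff by blast
  have "card A = card G" using bases_card_eq[OF A(1) assms(1)] .
  then have "card (insert x G - A) = 1"
    using A(3) finG assms(3) by (subst card_Diff_subset) (auto intro: finite_subset)
  then obtain y where y: "insert x G - A = {y}" by (rule card_1_singletonE)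
  then have "A = insert x G - {y}" "y \<in> G - D" using A by auto
  then show ?thesis using A(1) by blast
qed

lemma bases_exchange:
  assumes "F \<in> bases I" "G \<in> bases I" "x \<in> F - G"
  shows "\<exists>y\<in>G - F. insert x G - {y} \<in> bases I"
proof -
  have "F \<in> I" using assms(1) unfolding bases_def by blast
  \<comment> \<open>Protecting \<open>F \<inter> G\<close> forces the discarded element of
    \<open>G\<close> to lie outside \<open>F\<close>.\<close>
  then have "insert x (F \<inter> G) \<in> I" by (rule indep_hereditary) (use assms(3) in blast)
  then show ?thesis using basis_extend_insert[of G "F \<inter> G" x] assms by blast
qed

end

section \<open>Matroids from families of bases\<close>

text \<open>The assumed exchange prescribes the entering element, the derived one the leaving
  element. Induction on \<open>card (F - G)\<close> moves \<open>G\<close> towards \<open>F\<close>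
  while keeping \<open>x\<close> out of \<open>G\<close>.\<close>

lemma exchange_symmetric:
  assumes exch: "\<And>F G x. F \<in> \<B> \<Longrightarrow> G \<in> \<B> \<Longrightarrow> x \<in> F - G \<Longrightarrow> \<exists>y\<in>G - F. insert x G - {y} \<in> \<B>"
    and card: "\<And>F G. F \<in> \<B> \<Longrightarrow> G \<in> \<B> \<Longrightarrow> card F = card G"
    and fin: "\<And>F. F \<in> \<B> \<Longrightarrow> finite F"
    and "F \<in> \<B>" "G \<in> \<B>" "x \<in> F - G"
  shows "\<exists>y\<in>G - F. insert y (F - {x}) \<in> \<B>"
  using assms(4-6)
proof (induction "card (F - G)" arbitrary: G rule: less_induct)
  case less
  show ?case
  proof (cases "F - G = {x}")
    case True
    have "card (G - F) = card (F - G)"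
      using card[of F G] fin less.prems card_le_sym_Diff[of F G] card_le_sym_Diff[of G F] by force
    then have "card (G - F) = 1" using True by simp
    then obtain y where "G - F = {y}" by (rule card_1_singletonE)
    then have "insert y (F - {x}) = G" "y \<in> G - F" using True by auto
    then show ?thesis using less.prems by auto
  next
    case False
    then obtain z where z: "z \<in> F - G" "z \<noteq> x" using less.prems by blast
    \<comment> \<open>Trading \<open>z\<close> for \<open>w\<close> shrinks \<open>F - G\<close>;
      the newcomer \<open>z\<close> is in \<open>F\<close>, so any \<open>y\<close> found for the
      new set already lies in \<open>G - F\<close>.\<close>
    obtain w where w: "w \<in> G - F" "insert z G - {w} \<in> \<B>"
      using exch[OF less.prems(1,2) z(1)] by blast
    have "F - (insert z G - {w}) \<subset> F - G" using z w by blast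
    then have "card (F - (insert z G - {w})) < card (F - G)"
      using fin[OF less.prems(1)] by (intro psubset_card_mono) auto
    then have "\<exists>y\<in>insert z G - {w} - F. insert y (F - {x}) \<in> \<B>"
      using less.hyps less.prems w z by blast
    then show ?thesis using z by blast
  qed
qed

text \<open>For augmentation, \<open>X\<close> and \<open>Y\<close> are extended to bases
  \<open>P\<close> and \<open>Q\<close> that overlap as much as possible. A failure would confine
  \<open>P - Q\<close> to \<open>X\<close> and \<open>Q - P\<close> to \<open>Y\<close>, against
  \<open>card X < card Y\<close>.\<close>

lemma matroid_of_bases:
  assumes E: "finite E" "\<B> \<subseteq> Pow E" "\<B> \<noteq> {}"
    and exch: "\<And>F G x. F \<in> \<B> \<Longrightarrow> G \<in> \<B> \<Longrightarrow> x \<in> F - G \<Longrightarrow> \<exists>y\<in>G - F. insert x G - {y} \<in> \<B>"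
    and card: "\<And>F G. F \<in> \<B> \<Longrightarrow> G \<in> \<B> \<Longrightarrow> card F = card G"
  shows "matroid E {X. \<exists>B\<in>\<B>. X \<subseteq> B}" (is "matroid E ?I")
    and "bases {X. \<exists>B\<in>\<B>. X \<subseteq> B} = \<B>"
proof -
  have fin: "finite F" if "F \<in> \<B>" for F using that E finite_subset by blast
  have exch': "\<exists>y\<in>G - F. insert y (F - {x}) \<in> \<B>" if "F \<in> \<B>" "G \<in> \<B>" "x \<in> F - G" for F G x
    by (rule exchange_symmetric) (use exch card fin that in blast)+
  show "matroid E ?I"
  proof
    fix X Y assume "X \<in> ?I" "Y \<in> ?I" and less: "card X < card Y"
    then obtain P0 Q0 where PQ0: "P0 \<in> \<B>" "X \<subseteq> P0" "Q0 \<in> \<B>" "Y \<subseteq> Q0" by blast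
    \<comment> \<open>Packing both bases into a pair allows one maximization of their overlap,
      bounded by \<open>card E\<close>.\<close>
    define R where "R = (\<lambda>p. fst p \<in> \<B> \<and> snd p \<in> \<B> \<and> X \<subseteq> fst p \<and> Y \<subseteq> snd p)"
    have bnd: "\<forall>p. R p \<longrightarrow> card (fst p \<inter> snd p) < Suc (card E)"
      unfolding R_def using E by (metis PowD card_mono le_imp_less_Suc le_infI1 subsetD)
    have "R (P0, Q0)" using PQ0 unfolding R_def by simp
    from ex_has_greatest_nat[where P = R and f = "\<lambda>p. card (fst p \<inter> snd p)", OF this bnd]
    obtain P Q where PQ: "P \<in> \<B>" "Q \<in> \<B>" "X \<subseteq> P" "Y \<subseteq> Q"
      and PQ_max: "\<And>P' Q'. \<lbrakk>P' \<in> \<B>; Q' \<in> \<B>; X \<subseteq> P'; Y \<subseteq> Q'\<rbrakk> \<Longrightarrow> card (P' \<inter> Q') \<le> card (P \<inter> Q)"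
      unfolding R_def by auto
    show "\<exists>y\<in>Y - X. insert y X \<in> ?I"
    proof (rule ccontr)
      assume no: "\<not> ?thesis"
      have YP: "Y \<inter> P \<subseteq> X" using no PQ(1,3) by blast
      have QP: "Q - P \<subseteq> Y"
      proof (rule ccontr)
        assume "\<not> Q - P \<subseteq> Y"
        then obtain x where x: "x \<in> Q - P" "x \<notin> Y" by blast
        \<comment> \<open>The swap keeps \<open>Y\<close> inside the second basis, since
          \<open>x\<close> is not in \<open>Y\<close>, but enlarges the overlap.\<close>
        obtain y where y: "y \<in> P - Q" "insert y (Q - {x}) \<in> \<B>" using exch'[OF PQ(2,1) x(1)] by blast
        have "card (P \<inter> insert y (Q - {x})) \<le> card (P \<inter> Q)"
          using x y PQ by (intro PQ_max) auto
        moreover have "P \<inter> Q \<subset> P \<inter> insert y (Q - {x})" using x y by blast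
        ultimately show False using fin[OF PQ(1)] psubset_card_mono
          by (metis finite_Int linorder_not_le)
      qed
      have "P - Q \<subseteq> X"
      proof (rule ccontr)
        assume "\<not> P - Q \<subseteq> X"
        then obtain x where x: "x \<in> P - Q" "x \<notin> X" by blast
        \<comment> \<open>The new basis still contains \<open>X\<close> and gains \<open>y\<close>
          from \<open>Y\<close>, which is the augmentation assumed missing.\<close>
        obtain y where y: "y \<in> Q - P" "insert y (P - {x}) \<in> \<B>" using exch'[OF PQ(1,2) x(1)] by blast
        then have "y \<in> Y - X" "insert y X \<subseteq> insert y (P - {x})" using QP PQ(3) x by auto
        then show False using no y(2) by blast
      qed
      then have sub: "P - Q \<subseteq> X - Y" using PQ by blast
      have fins: "finite X" "finite Y" "finite P" "finite Q"
        using fin PQ finite_subset by blast+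
      have "card (P - Q) \<le> card (X - Y)" using sub fins by (simp add: card_mono)
      moreover have "Y - X \<subseteq> Q - P" using YP PQ by blast
      then have "card (Y - X) \<le> card (Q - P)" using fins by (simp add: card_mono)
      moreover have "card (Q - P) \<le> card (P - Q)"
        using card[OF PQ(1,2)] fins card_le_sym_Diff[of Q P] by simp
      moreover have "card (X - Y) < card (Y - X)"
        using less fins card_less_sym_Diff[of X Y] by simp
      ultimately show False by linarith
    qed
  next
    fix X Y assume "X \<in> ?I" "Y \<subseteq> X"
    then show "Y \<in> ?I" by blast
  qed (use E in auto)
  show "bases ?I = \<B>"
  proof
    show "bases ?I \<subseteq> \<B>" unfolding bases_def by blast
    show "\<B> \<subseteq> bases ?I"
    proof
      fix B assume B: "B \<in> \<B>"
      have "X = B" if "C \<in> \<B>" "X \<subseteq> C" "B \<subseteq> X" for X C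
        using that card_subset_eq[OF fin[OF that(1)], of B] card[OF B that(1)] by auto
      then show "B \<in> bases ?I" using B unfolding bases_def by blast
    qed
  qed
qed

section \<open>Lifts and fundamental circuits\<close>

lemma flats_mono_imp_exchangeable:
  assumes N: "matroid E N" and M: "matroid E M" and flats: "flats E M \<subseteq> flats E N"
    and F: "F \<in> bases N" and e: "e \<in> E - F"
  shows "\<exists>G\<in>bases M. G \<subseteq> F \<and> exchangeable (bases M) G e \<subseteq> exchangeable (bases N) F e"
proof -
  interpret N: matroid E N by fact
  interpret M: matroid E M by fact
  have FN: "F \<in> N" using F unfolding bases_def by blast
  have FE: "F \<subseteq> E" using FN N.indep_subset_ground by blast
  \<comment> \<open>The \<open>M\<close>-closure of \<open>B\<close> is a flat of \<open>M\<close>,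
    hence of \<open>N\<close>; it contains \<open>A\<close> but not \<open>x\<close>.\<close>
  have N_extends: "insert x A \<in> N"
    if "B \<in> M" "x \<in> E" "x \<notin> B" "insert x B \<in> M" "A \<in> N" "A \<subseteq> E"
      "\<And>a. a \<in> A \<Longrightarrow> a \<in> B \<or> insert a B \<notin> M" for A B x
  proof -
    have "{x \<in> E. x \<in> B \<or> insert x B \<notin> M} \<in> flats E N"
      using M.closure_of_indep_is_flat[OF that(1)] flats by blast
    then show ?thesis using that unfolding N.flat_iff by blast
  qed
  have maximalD: "a \<in> B \<or> insert a B \<notin> M"
    if "B \<in> M" "B \<subseteq> S" "\<And>Y. Y \<in> M \<Longrightarrow> Y \<subseteq> S \<Longrightarrow> card Y \<le> card B" "a \<in> S" for a B S
    using that(3)[of "insert a B"] that M.indep_finite[OF that(1)] by (auto simp: card_insert_if)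
  \<comment> \<open>The fundamental \<open>N\<close>-circuit of \<open>e\<close> over
    \<open>F\<close>, here with \<open>e\<close> itself left out.\<close>
  define C where "C = {f \<in> F. insert e F - {f} \<in> bases N}"
  have CF: "C \<subseteq> F" unfolding C_def by blast
  have CN: "C \<in> N" using N.indep_hereditary[OF FN CF] .
  have C_dep: "insert e C \<notin> N"
    using N.basis_extend_insert[OF F CF] e unfolding C_def by blast
  obtain A where A: "A \<in> M" "A \<subseteq> C"
    and A_max: "\<And>Y. Y \<in> M \<Longrightarrow> Y \<subseteq> C \<Longrightarrow> card Y \<le> card A"
    using M.max_indep_exists[OF M.empty_indep, of C] by auto
  \<comment> \<open>Otherwise \<open>e\<close> avoids the \<open>M\<close>-closure of
    \<open>A\<close>, which contains \<open>C\<close>, and \<open>N_extends\<close> makes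
    \<open>insert e C\<close> independent.\<close>
  have A_dep: "insert e A \<notin> M"
    using N_extends[OF A(1) _ _ _ CN] maximalD[OF A A_max] C_dep CF FE A(2) e by blast
  obtain G where G: "G \<in> M" "A \<subseteq> G" "G \<subseteq> F"
    and G_max: "\<And>Y. Y \<in> M \<Longrightarrow> Y \<subseteq> F \<Longrightarrow> card Y \<le> card G"
    using M.max_indep_exists[OF A(1), of F] A(2) CF by (metis subset_trans)
  have G_basis: "G \<in> bases M"
  proof (rule ccontr)
    assume "G \<notin> bases M"
    then obtain Y where Y: "Y \<in> M" "card G < card Y"
      using G(1) unfolding M.bases_iff by (meson linorder_not_le)
    then obtain x where x: "x \<notin> G" "insert x G \<in> M" using M.indep_augment[OF G(1)] by blast
    then have xE: "x \<in> E" using M.indep_subset_ground by blast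
    \<comment> \<open>\<open>F\<close> lies in the \<open>M\<close>-closure of \<open>G\<close>
      while \<open>x\<close> does not. The basis \<open>F\<close> then has to contain
      \<open>x\<close>, against the choice of \<open>G\<close>.\<close>
    have "insert x F \<in> N"
      using N_extends[OF G(1) xE x FN FE] maximalD[OF G(1,3) G_max] by blast
    then have "x \<in> F" using F unfolding bases_def by blast
    then show False using maximalD[OF G(1,3) G_max] x by blast
  qed
  have "f \<in> exchangeable (bases N) F e" if f: "f \<in> exchangeable (bases M) G e" for f
  proof (cases "f = e")
    case True
    then show ?thesis using F e unfolding exchangeable_def by simp
  next
    case False
    have "insert e G - {f} \<in> M" using f unfolding exchangeable_def bases_def by simp
    \<comment> \<open>An exchange restoring independence must break \<open>insert e A\<close>, so
      \<open>f\<close> comes from \<open>A\<close>, inside \<open>C\<close>.\<close>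
    then have "\<not> insert e A \<subseteq> insert e G - {f}" using M.indep_hereditary A_dep by blast
    then have "f \<in> A" using False G(2) by blast
    then show ?thesis using A(2) unfolding C_def exchangeable_def by auto
  qed
  then show ?thesis using G_basis G(3) by blast
qed

lemma exchangeable_imp_flats_mono:
  assumes N: "matroid E N" and M: "matroid E M"
    and exch: "\<And>F e. F \<in> bases N \<Longrightarrow> e \<in> E - F \<Longrightarrow>
      \<exists>G\<in>bases M. G \<subseteq> F \<and> exchangeable (bases M) G e \<subseteq> exchangeable (bases N) F e"
  shows "flats E M \<subseteq> flats E N"
proof
  interpret N: matroid E N by fact
  interpret M: matroid E M by fact
  fix X assume X: "X \<in> flats E M"
  have "insert e A \<in> N" if e: "e \<in> E - X" and A: "A \<in> N" "A \<subseteq> X" for e A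
  proof (rule ccontr)
    assume dep: "insert e A \<notin> N"
    obtain F where F: "F \<in> N" "A \<subseteq> F" "\<And>Y. Y \<in> N \<Longrightarrow> card Y \<le> card F"
      using N.max_indep_exists[OF A(1), of E] A N.indep_subset_ground by (metis PowD subsetD)
    then have F_basis: "F \<in> bases N" unfolding N.bases_iff by blast
    have eF: "e \<notin> F" using dep F N.indep_hereditary[of F "insert e A"] by blast
    then obtain G where G: "G \<in> bases M" "G \<subseteq> F"
      and sub: "exchangeable (bases M) G e \<subseteq> exchangeable (bases N) F e"
      using exch[OF F_basis] e by blast
    \<comment> \<open>The flat \<open>X\<close> lets \<open>e\<close> join
      \<open>G \<inter> X\<close>, so the exchange can discard some \<open>f\<close> outside
      \<open>X\<close>, hence outside \<open>A\<close>.\<close>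
    have "G \<inter> X \<in> M" using G(1) M.indep_hereditary[of G] unfolding bases_def by blast
    then have "insert e (G \<inter> X) \<in> M" using X e unfolding M.flat_iff by blast
    then obtain f where f: "f \<in> G - X" "insert e G - {f} \<in> bases M"
      using M.basis_extend_insert[OF G(1), of "G \<inter> X" e] eF G(2) by blast
    then have "f \<in> exchangeable (bases N) F e"
      using sub unfolding exchangeable_def by auto
    then have "insert e F - {f} \<in> N" unfolding exchangeable_def bases_def by simp
    moreover have "insert e A \<subseteq> insert e F - {f}" using f A F(2) e G(2) eF by blast
    ultimately show False using dep N.indep_hereditary by blast
  qed
  then show "X \<in> flats E N" using X unfolding N.flat_iff M.flat_iff by blast
qed

section \<open>Axiom 2 on consecutive cardinalities\<close>

text \<open>Removing an element of \<open>G \<union> {e}\<close> restores the size of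
  \<open>G\<close>, so exchanges stay within one layer and may be computed there.\<close>

lemma exchangeable_restrict_card:
  assumes "finite G" "e \<notin> G"
  shows "exchangeable {F \<in> \<F>. card F = card G} G e = exchangeable \<F> G e"
proof -
  have "card ((G \<union> {e}) - {f}) = card G" if "f \<in> G \<union> {e}" for f
    using assms that by (simp add: card_Diff_singleton)
  then show ?thesis unfolding exchangeable_def by blast
qed

text \<open>The smallest cardinality is \<open>j 1\<close> and the one just below
  \<open>j (i + 1)\<close> is \<open>j i\<close>. This brings \<open>axiom2\<close> into the form in
  which the two lemmas on lifts compare consecutive layers.\<close>

lemma axiom2_iff_consecutive:
  fixes j :: "nat \<Rightarrow> nat" and k :: nat
  assumes E: "finite E" "\<F> \<subseteq> Pow E"
    and j: "strict_mono_on {1..k} j" "j ` {1..k} = card ` \<F>"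
  shows "axiom2 E \<F> \<longleftrightarrow>
    (\<forall>i\<in>{1..<k}. \<forall>F\<in>{F \<in> \<F>. card F = j (i + 1)}. \<forall>e\<in>E - F. \<exists>G\<in>{F \<in> \<F>. card F = j i}.
      G \<subseteq> F \<and> exchangeable {F \<in> \<F>. card F = j i} G e
        \<subseteq> exchangeable {F \<in> \<F>. card F = j (i + 1)} F e)"
    (is "_ \<longleftrightarrow> (\<forall>i\<in>_. \<forall>F\<in>_. \<forall>e\<in>_. ?P i F e)")
proof -
  have finF: "finite \<F>" using E finite_subset by blast
  have fin: "finite F" if "F \<in> \<F>" for F using that E finite_subset by blast
  have j_less: "j a < j b \<longleftrightarrow> a < b" if "a \<in> {1..k}" "b \<in> {1..k}" for a b
    using strict_mono_on_less[OF j(1)] that by blast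
  have index: "\<exists>a\<in>{1..k}. card F = j a" if "F \<in> \<F>" for F
    using that j(2) by (metis imageE imageI)
  have member: "\<exists>S\<in>\<F>. card S = j a" if "a \<in> {1..k}" for a
    using that j(2) by (metis imageE imageI)
  have Min_card: "Min (card ` \<F>) = j 1" if "1 \<le> k"
  proof (rule Min_eqI)
    show "finite (card ` \<F>)" using finF by simp
    show "j 1 \<in> card ` \<F>" using that j(2) by (metis atLeastAtMost_iff imageI order_refl)
    fix n assume "n \<in> card ` \<F>"
    then obtain a where "a \<in> {1..k}" "n = j a" using j(2) by (metis imageE)
    then show "j 1 \<le> n" using j_less[of a 1] that by force
  qed
  have Max_card: "Max {card S | S. S \<in> \<F> \<and> card S < j (i + 1)} = j i" if i: "i \<in> {1..<k}" for i
  proof (rule Max_eqI)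
    show "finite {card S | S. S \<in> \<F> \<and> card S < j (i + 1)}" using finF by simp
    obtain S where "S \<in> \<F>" "card S = j i" using member[of i] i by auto
    then show "j i \<in> {card S | S. S \<in> \<F> \<and> card S < j (i + 1)}"
      using j_less[of i "i + 1"] i by force
    fix n assume "n \<in> {card S | S. S \<in> \<F> \<and> card S < j (i + 1)}"
    then obtain a where "a \<in> {1..k}" "n = j a" "j a < j (i + 1)" using index by force
    then show "n \<le> j i" using j_less[of a "i + 1"] j_less[of i a] i by force
  qed
  have nonmin: "card F \<noteq> Min (card ` \<F>) \<longleftrightarrow> (\<exists>i\<in>{1..<k}. card F = j (i + 1))"
    if F: "F \<in> \<F>" for F
  proof -
    obtain a where a: "a \<in> {1..k}" "card F = j a" using index[OF F] by blast
    have j_eq: "j a = j b \<longleftrightarrow> a = b" if "b \<in> {1..k}" for b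
      using strict_mono_on_eqD[OF j(1), of a b] a(1) that by auto
    have "a \<noteq> 1 \<longleftrightarrow> (\<exists>i\<in>{1..<k}. a = i + 1)"
    proof
      assume "a \<noteq> 1"
      then have "a - 1 \<in> {1..<k}" "a = a - 1 + 1" using a(1) by auto
      then show "\<exists>i\<in>{1..<k}. a = i + 1" by blast
    qed auto
    moreover have "Min (card ` \<F>) = j 1" using Min_card a(1) by simp
    moreover have "j a = j 1 \<longleftrightarrow> a = 1" using a(1) by (intro j_eq) auto
    moreover have "j a = j (i + 1) \<longleftrightarrow> a = i + 1" if "i \<in> {1..<k}" for i
      using that by (intro j_eq) auto
    ultimately show ?thesis unfolding a(2) by simp
  qed
  \<comment> \<open>A member of minimum size, set against \<open>F\<close>, witnesses the premise of
    \<open>axiom2\<close>.\<close>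
  have diff: "\<exists>S\<in>\<F>. \<exists>T\<in>\<F>. card S \<noteq> card T" if "F \<in> \<F>" "card F \<noteq> Min (card ` \<F>)" for F
  proof -
    have "Min (card ` \<F>) \<in> card ` \<F>" using finF that(1) by (intro Min_in) auto
    then obtain T where "T \<in> \<F>" "card T = Min (card ` \<F>)" by (metis imageE)
    then show ?thesis using that by metis
  qed
  have step: "(\<exists>G\<in>\<F>. G \<subset> F \<and> card G = Max {card S | S. S \<in> \<F> \<and> card S < card F} \<and>
           exchangeable \<F> G e \<subseteq> exchangeable \<F> F e) \<longleftrightarrow> ?P i F e"
    if "i \<in> {1..<k}" "F \<in> \<F>" "card F = j (i + 1)" "e \<in> E - F" for i F e
  proof -
    have less: "j i < j (i + 1)" using j_less[of i "i + 1"] that(1) by auto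
    have exch_F: "exchangeable {F \<in> \<F>. card F = j (i + 1)} F e = exchangeable \<F> F e"
      using exchangeable_restrict_card[OF fin, of F e] that by simp
    have exch_G: "exchangeable {F \<in> \<F>. card F = j i} G e = exchangeable \<F> G e"
      if "G \<in> \<F>" "card G = j i" "G \<subseteq> F" for G
      using exchangeable_restrict_card[OF fin, of G e] that \<open>e \<in> E - F\<close> by auto
    have psubset: "G \<subset> F \<longleftrightarrow> G \<subseteq> F" if "card G = j i" for G
      using that less \<open>card F = j (i + 1)\<close> by auto
    show ?thesis unfolding that(3) Max_card[OF that(1)] exch_F
    proof (intro iffI; elim bexE conjE)
      fix G assume "G \<in> \<F>" "G \<subset> F" "card G = j i" "exchangeable \<F> G e \<subseteq> exchangeable \<F> F e"
      then show "\<exists>G\<in>{F \<in> \<F>. card F = j i}. G \<subseteq> F \<and>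
          exchangeable {F \<in> \<F>. card F = j i} G e \<subseteq> exchangeable \<F> F e"
        using exch_G[of G] by (intro bexI[of _ G]) simp_all
    next
      fix G assume G: "G \<in> {F \<in> \<F>. card F = j i}" "G \<subseteq> F"
        "exchangeable {F \<in> \<F>. card F = j i} G e \<subseteq> exchangeable \<F> F e"
      then show "\<exists>G\<in>\<F>. G \<subset> F \<and> card G = j i \<and> exchangeable \<F> G e \<subseteq> exchangeable \<F> F e"
        using exch_G[of G] psubset[of G] by (intro bexI[of _ G]) simp_all
    qed
  qed
  define Q where "Q F \<longleftrightarrow> (\<forall>e\<in>E - F. \<exists>G\<in>\<F>. G \<subset> F \<and>
      card G = Max {card S | S. S \<in> \<F> \<and> card S < card F} \<and>
      exchangeable \<F> G e \<subseteq> exchangeable \<F> F e)" for F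
  have "axiom2 E \<F> \<longleftrightarrow> (\<forall>F\<in>\<F>. card F \<noteq> Min (card ` \<F>) \<longrightarrow> Q F)"
    unfolding axiom2_def Q_def[symmetric] using diff by blast
  also have "\<dots> \<longleftrightarrow> (\<forall>i\<in>{1..<k}. \<forall>F\<in>{F \<in> \<F>. card F = j (i + 1)}. Q F)"
    using nonmin by blast
  also have "\<dots> \<longleftrightarrow> (\<forall>i\<in>{1..<k}. \<forall>F\<in>{F \<in> \<F>. card F = j (i + 1)}. \<forall>e\<in>E - F. ?P i F e)"
    unfolding Q_def by (intro ball_cong refl step) auto
  finally show ?thesis .
qed

section \<open>From the axioms to a chain of lifts and back\<close>

theorem theorem3p5:
  fixes E :: "'a set" and \<F> :: "'a set set" and j :: "nat \<Rightarrow> nat" and k :: nat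
  assumes "finite E"
    and "\<F> \<subseteq> Pow E"
    and "strict_mono_on {1..k} j"
    and "j ` {1..k} = card ` \<F>"
  shows "axiom1 \<F> \<and> axiom2 E \<F> \<longleftrightarrow>
    (\<exists>M :: nat \<Rightarrow> 'a set set.
       (\<forall>i\<in>{1..k}. matroid E (M i) \<and> bases (M i) = {F \<in> \<F>. card F = j i}) \<and>
       (\<forall>i\<in>{1..<k}. nontrivial_lift E (M (i + 1)) (M i)))"
proof -
  define \<B> where "\<B> i = {F \<in> \<F>. card F = j i}" for i
  note axiom2_iff = axiom2_iff_consecutive[OF assms, folded \<B>_def]
  have fin: "finite F" if "F \<in> \<F>" for F using that assms(1,2) finite_subset by blast
  have ne: "\<B> i \<noteq> {}" if "i \<in> {1..k}" for i
  proof -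
    have "j i \<in> card ` \<F>" using that assms(4) by blast
    then show ?thesis unfolding \<B>_def by auto
  qed
  have index: "\<exists>i\<in>{1..k}. F \<in> \<B> i" if "F \<in> \<F>" for F
  proof -
    have "card F \<in> j ` {1..k}" using that assms(4) by blast
    then show ?thesis using that unfolding \<B>_def by blast
  qed
  show ?thesis unfolding \<B>_def[symmetric]
  proof
    assume ax: "axiom1 \<F> \<and> axiom2 E \<F>"
    \<comment> \<open>Independent sets of a matroid are the subsets of its bases, so this choice is
      forced.\<close>
    define M where "M i = {X. \<exists>B\<in>\<B> i. X \<subseteq> B}" for i
    have exch: "\<exists>y\<in>G - F. insert x G - {y} \<in> \<B> i"
      if FG: "F \<in> \<B> i" "G \<in> \<B> i" and x: "x \<in> F - G" for F G x i
    proof -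
      have mem: "F \<in> \<F>" "G \<in> \<F>" "card F = j i" "card G = j i" using FG unfolding \<B>_def by auto
      then have "\<exists>y\<in>G - F. (G \<union> {x}) - {y} \<in> \<F>"
        using ax[THEN conjunct1, unfolded axiom1_def, rule_format, of F G x] x by simp
      then obtain y where y: "y \<in> G - F" "(G \<union> {x}) - {y} \<in> \<F>" by blast
      \<comment> \<open>Keeping the size puts the exchanged set into the same layer.\<close>
      have "card (insert x G - {y}) = card G" using y(1) x fin[OF mem(2)] by simp
      then show ?thesis using y mem unfolding \<B>_def by auto
    qed
    have M: "matroid E (M i)" "bases (M i) = \<B> i" if "i \<in> {1..k}" for i
    proof -
      have "\<B> i \<subseteq> Pow E" "\<And>F G. F \<in> \<B> i \<Longrightarrow> G \<in> \<B> i \<Longrightarrow> card F = card G"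
        using assms(2) unfolding \<B>_def by auto
      note B = matroid_of_bases[OF assms(1) this(1) ne[OF that] exch this(2)]
      show "matroid E (M i)" unfolding M_def by (rule B(1))
      show "bases (M i) = \<B> i" unfolding M_def by (rule B(2))
    qed
    have "nontrivial_lift E (M (i + 1)) (M i)" if i: "i \<in> {1..<k}" for i
    proof -
      have i': "i \<in> {1..k}" "i + 1 \<in> {1..k}" using i by auto
      have "flats E (M i) \<subseteq> flats E (M (i + 1))"
      proof (rule exchangeable_imp_flats_mono)
        fix F e assume "F \<in> bases (M (i + 1))" "e \<in> E - F"
        then show "\<exists>G\<in>bases (M i). G \<subseteq> F \<and>
            exchangeable (bases (M i)) G e \<subseteq> exchangeable (bases (M (i + 1))) F e"
          using ax i unfolding axiom2_iff M(2)[OF i'(1)] M(2)[OF i'(2)] by blast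
      qed (use M i' in auto)
      moreover have "j i < j (i + 1)" using i' assms(3) by (simp add: strict_mono_onD)
      \<comment> \<open>Equal matroids would share their bases, but the two layers are disjoint and
        nonempty.\<close>
      then have "\<B> i \<inter> \<B> (i + 1) = {}" unfolding \<B>_def by auto
      then have "M (i + 1) \<noteq> M i" using M(2) i' ne by (metis Int_absorb)
      ultimately show ?thesis using M i' unfolding nontrivial_lift_def is_lift_def by blast
    qed
    then show "\<exists>M. (\<forall>i\<in>{1..k}. matroid E (M i) \<and> bases (M i) = \<B> i) \<and>
        (\<forall>i\<in>{1..<k}. nontrivial_lift E (M (i + 1)) (M i))"
      using M by blast
  next
    assume "\<exists>M. (\<forall>i\<in>{1..k}. matroid E (M i) \<and> bases (M i) = \<B> i) \<and>
        (\<forall>i\<in>{1..<k}. nontrivial_lift E (M (i + 1)) (M i))"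
    then obtain M where M: "\<And>i. i \<in> {1..k} \<Longrightarrow> matroid E (M i)"
        "\<And>i. i \<in> {1..k} \<Longrightarrow> bases (M i) = \<B> i"
      and lift: "\<And>i. i \<in> {1..<k} \<Longrightarrow> nontrivial_lift E (M (i + 1)) (M i)"
      by blast
    have "axiom1 \<F>"
      unfolding axiom1_def
    proof (intro ballI allI impI)
      fix F G x assume F: "F \<in> \<F>" and G: "G \<in> \<F>" and x: "card F = card G \<and> x \<in> F - G"
      obtain i where i: "i \<in> {1..k}" "F \<in> \<B> i" using index[OF F] by blast
      \<comment> \<open>Equal cardinality places both sets among the bases of one matroid, where
        exchange is available.\<close>
      then have "G \<in> \<B> i" using G x unfolding \<B>_def by simp
      then have "\<exists>y\<in>G - F. insert x G - {y} \<in> \<B> i"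
        using matroid.bases_exchange[OF M(1)[OF i(1)], of F G x] M(2) i x by simp
      then show "\<exists>y\<in>G - F. (G \<union> {x}) - {y} \<in> \<F>" unfolding \<B>_def by auto
    qed
    moreover have "axiom2 E \<F>"
      unfolding axiom2_iff
    proof (intro ballI)
      fix i F e assume i: "i \<in> {1..<k}" and F: "F \<in> \<B> (i + 1)" and e: "e \<in> E - F"
      have i': "i \<in> {1..k}" "i + 1 \<in> {1..k}" using i by auto
      have "flats E (M i) \<subseteq> flats E (M (i + 1))"
        using lift[OF i] unfolding nontrivial_lift_def is_lift_def by blast
      then show "\<exists>G\<in>\<B> i. G \<subseteq> F \<and> exchangeable (\<B> i) G e \<subseteq> exchangeable (\<B> (i + 1)) F e"
        using flats_mono_imp_exchangeable[OF M(1)[OF i'(2)] M(1)[OF i'(1)], of F e] F e M(2) i'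
        by simp
    qed
    ultimately show "axiom1 \<F> \<and> axiom2 E \<F>" by blast
  qed
qed

end
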